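(* Let $n\ge 1$ and $1<p\le2$. The pivotal condition does not imply the one tailed $\mathcal{A}_p^{t_1}$ condition: there exist locally finite positive Borel measures $\omega,\sigma$ on $\mathbb{R}^n$ such that $\mathcal{V}(\omega,\sigma)<\infty$ but $\mathcal{A}_p^{t_1}(\omega,\sigma)=\infty$.
   Context: $|I|$ is the Lebesgue measure of the cube $I$, and $p'=p/(p-1)$. For a locally finite positive Borel measure $\mu$ on $\mathbb{R}^n$ and a cube $I$ define $$P(I,\mu)=\int_{\mathbb{R}^n}\left(\frac{|I|^{1/n}}{(|I|^{1/n}+\operatorname{dist}(x,I))^2}\right)^n\mu(dx).$$ One tailed condition: $\mathcal{A}_p^{t_1}(\omega,\sigma)=\sup_I\left(\frac{\omega(I)}{|I|}\right)^{1/p}P(I,\sigma)^{1/p'}$, supremum over all cubes $I$. Pivotal condition: $\mathcal{V}(\omega,\sigma)<\infty$, where $$\mathcal{V}(\omega,\sigma)^p=\sup_{I_0=\cup I_r}\frac{1}{\sigma(I_0)}\sum_{r\ge1}\omega(I_r)\,P(I_r,\mathbf{1}_{I_0}\sigma)^p,$$ the supremum being taken over all cubes $I_0$ with $\sigma(I_0)\ne0$ and all decompositions of $I_0$ into disjoint cubes $\{I_r\}_{r\in\mathbb{N}}$. *)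

theory Defs
  imports "HOL-Analysis.Analysis"
begin

(* Only meant for exponents a > 0, for which 0 and \<infinity> are mapped to themselves. *)
definition ennpowr :: "ennreal \<Rightarrow> real \<Rightarrow> ennreal" where
  "ennpowr x a = (if x = \<infinity> then \<infinity> else ennreal (enn2real x powr a))"

(* Cubes are half-open with sides parallel to the axes, so that a cube can be decomposed
   into countably many cubes that are literally disjoint. *)
definition cube :: "real ^ 'n \<Rightarrow> real \<Rightarrow> (real ^ 'n) set" where
  "cube a l = {x. \<forall>i. a $ i \<le> x $ i \<and> x $ i < a $ i + l}"

definition cubes :: "(real ^ 'n) set set" where
  "cubes = {cube a l | a l. l > 0}"

definition locally_finite_borel :: "(real ^ 'n) measure \<Rightarrow> bool" where
  "locally_finite_borel \<mu> \<longleftrightarrow>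
     sets \<mu> = sets borel \<and> (\<forall>x. \<exists>U. open U \<and> x \<in> U \<and> emeasure \<mu> U < \<infinity>)"

definition side :: "(real ^ 'n) set \<Rightarrow> real" where
  "side I = measure lborel I powr (1 / real CARD('n))"

definition poisson :: "(real ^ 'n) set \<Rightarrow> (real ^ 'n) measure \<Rightarrow> ennreal" where
  "poisson I \<mu> =
     (\<integral>\<^sup>+ x. ennreal ((side I / (side I + infdist x I)\<^sup>2) ^ CARD('n)) \<partial>\<mu>)"

(* Products are taken in ennreal, where 0 * \<infinity> = 0. *)
definition one_tailed_A :: "real \<Rightarrow> (real ^ 'n) measure \<Rightarrow> (real ^ 'n) measure \<Rightarrow> ennreal" where
  "one_tailed_A p \<omega> \<sigma> =
     (SUP I\<in>cubes. ennpowr (emeasure \<omega> I / emeasure lborel I) (1 / p)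
                 * ennpowr (poisson I \<sigma>) (1 / (p / (p - 1))))"

(* Both finite and countably infinite decompositions are admitted. *)
definition cube_decomposition :: "(real ^ 'n) set \<Rightarrow> (real ^ 'n) set set \<Rightarrow> bool" where
  "cube_decomposition I0 D \<longleftrightarrow> countable D \<and> D \<subseteq> cubes \<and> disjoint D \<and> \<Union>D = I0"

definition pivotal_V :: "real \<Rightarrow> (real ^ 'n) measure \<Rightarrow> (real ^ 'n) measure \<Rightarrow> ennreal" where
  "pivotal_V p \<omega> \<sigma> =
     ennpowr
       (SUP (I0, D) \<in> {(I0, D). I0 \<in> cubes \<and> emeasure \<sigma> I0 \<noteq> 0 \<and> cube_decomposition I0 D}.
          1 / emeasure \<sigma> I0 *
          (\<Sum>\<^sub>\<infinity>I\<in>D. emeasure \<omega> I * ennpowr (poisson I (density \<sigma> (indicator I0))) p))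
       (1 / p)"

end

theory Submission
  imports Defs "HOL-Probability.Giry_Monad"
begin

text \<open>
  Let \<open>n\<close> be the dimension. The first measure is \<open>\<omega> = \<delta>\<^sub>0\<close>, and the
  second, \<open>\<sigma>\<close>, puts the mass \<open>4\<^sup>n\<^sup>k\<close> at the point \<open>x\<^sub>k\<close>
  of the main diagonal with all coordinates equal to \<open>2\<^sup>k\<close>, for \<open>k = 0, 1, 2, \<dots>\<close>.
  The Poisson kernel of a fixed cube decays like \<open>|x|\<close> to the power \<open>-2n\<close>, which the masses
  compensate: every atom adds about the same amount to the full Poisson integral of the unit cube, which therefore
  diverges (\<open>poisson_lacunary_infinite\<close>); as that cube carries the mass of \<open>\<omega>\<close>, the one
  tailed supremum is infinite.

  In the pivotal sum, disjointness leaves at most one nonzero term, the one for the cube \<open>I\<close> of the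
  decomposition that contains the origin. By convexity and \<open>\<sigma>(I\<^sub>0) \<noteq> 0\<close>, the cube
  \<open>I\<^sub>0\<close> then contains exactly the points \<open>x\<^sub>0, \<dots>, x\<^sub>K\<close> for some
  \<open>K\<close> (\<open>diag_points_in_cube\<close>), so \<open>\<sigma>(I\<^sub>0) \<ge> 4\<^sup>n\<^sup>K\<close>.
  No matter how large or small \<open>I\<close> is, its side \<open>l\<close> and the distance \<open>d\<close> of
  \<open>x\<^sub>k\<close> to it satisfy \<open>l + d \<ge> 2\<^sup>k / n\<close>. Since \<open>l / (l + d)\<^sup>2
  \<le> 1 / (l + d)\<close>, the atom at \<open>x\<^sub>k\<close> contributes at most a constant times
  \<open>2\<^sup>n\<^sup>k\<close> (\<open>poisson_kernel_le\<close>). This is a geometric progression, so the truncated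
  Poisson integral is \<open>O(2\<^sup>n\<^sup>K)\<close>, hence at most a constant times the square root of
  \<open>\<sigma>(I\<^sub>0)\<close>. Its \<open>p\<close>-th power is bounded by a constant times
  \<open>\<sigma>(I\<^sub>0)\<close> because \<open>p \<le> 2\<close> and \<open>2\<^sup>n\<^sup>K \<ge> 1\<close>
  (\<open>pivotal_summand_le\<close>).
\<close>

section \<open>Half-open cubes\<close>

text \<open>The volume of a half-open cube is squeezed between those of the open and the closed box.\<close>

lemma cube_sandwich:
  fixes a :: "real ^ 'n"
  shows "box a (a + (\<chi> i. l)) \<subseteq> cube a l" and "cube a l \<subseteq> cbox a (a + (\<chi> i. l))"
  by (auto simp: cube_def mem_box_cart less_imp_le)

lemma cube_borel [measurable]:
  fixes a :: "real ^ 'n"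
  shows "cube a l \<in> sets borel"
proof -
  have "cube a l = (\<Inter>i. {x. a $ i \<le> x $ i} \<inter> {x. x $ i < a $ i + l})"
    by (auto simp: cube_def)
  moreover have "{x :: real ^ 'n. a $ i \<le> x $ i} \<inter> {x. x $ i < a $ i + l} \<in> sets borel" for i
    by (intro sets.Int borel_closed borel_open closed_halfspace_component_ge_cart
        open_halfspace_component_lt_cart)
  ultimately show ?thesis by auto
qed

lemma cubes_borel: "I \<in> cubes \<Longrightarrow> I \<in> sets borel"
  by (auto simp: cubes_def)

lemma emeasure_lborel_cube:
  fixes a :: "real ^ 'n"
  assumes "l > 0"
  shows "emeasure lborel (cube a l) = ennreal (l ^ CARD('n))"
proof -
  let ?b = "a + (\<chi> i. l)"
  have 1: "emeasure lborel (cbox a ?b) = ennreal (l ^ CARD('n))"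
  proof -
    have "cbox a ?b \<noteq> {}" using assms by (auto simp: interval_ne_empty_cart)
    then have "measure lborel (cbox a ?b) = l ^ CARD('n)"
      by (simp add: content_cbox_cart)
    then show ?thesis
      using emeasure_lborel_cbox_finite[of a ?b] by (simp add: emeasure_eq_ennreal_measure less_top)
  qed
  have 2: "emeasure lborel (box a ?b) = emeasure lborel (cbox a ?b)"
    by (simp add: emeasure_lborel_box_eq emeasure_lborel_cbox_eq)
  show ?thesis
    using emeasure_mono[OF cube_sandwich(1)[of a l], of lborel]
      emeasure_mono[OF cube_sandwich(2)[of a l], of lborel] 1 2
    by (auto intro: antisym)
qed

lemma side_cube:
  fixes a :: "real ^ 'n"
  assumes "l > 0"
  shows "side (cube a l) = l"
proof -
  have "measure lborel (cube a l) = l powr real CARD('n)"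
    using emeasure_lborel_cube[OF assms, of a] assms by (simp add: measure_def powr_realpow)
  then show ?thesis using assms by (simp add: side_def powr_powr)
qed

text \<open>
  A cube through the origin lies within \<open>n l\<close> of it, so a far away point is either far from the cube
  or the cube is large. This makes the kernel bound below uniform in the size of the cube.
\<close>

lemma norm_le_infdist_cube:
  fixes a x :: "real ^ 'n"
  assumes "0 \<in> cube a l"
  shows "norm x \<le> infdist x (cube a l) + real CARD('n) * l"
proof -
  have "norm y \<le> real CARD('n) * l" if "y \<in> cube a l" for y
  proof -
    have "\<bar>y $ i\<bar> \<le> l" for i
    proof -
      have "a $ i \<le> y $ i" "y $ i < a $ i + l" "a $ i \<le> 0" "0 < a $ i + l"
        using that assms by (auto simp: cube_def)
      then show ?thesis by linarith
    qed
    then have "(\<Sum>i\<in>UNIV. \<bar>y $ i\<bar>) \<le> (\<Sum>i\<in>(UNIV :: 'n set). l)" by (rule sum_mono)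
    then show ?thesis using norm_le_l1_cart[of y] by simp
  qed
  then have "norm x - real CARD('n) * l \<le> dist x y" if "y \<in> cube a l" for y
    using that norm_triangle_sub[of x y] by (smt (verit) dist_norm)
  moreover have "cube a l \<noteq> {}" using assms by auto
  ultimately have "norm x - real CARD('n) * l \<le> infdist x (cube a l)"
    unfolding infdist_def by (simp add: cINF_greatest)
  then show ?thesis by simp
qed

section \<open>Powers of extended nonnegative reals\<close>

lemma ennpowr_le:
  assumes "x \<le> ennreal r" and "0 \<le> r" and "0 \<le> a"
  shows "ennpowr x a \<le> ennreal (r powr a)"
proof -
  have "x \<noteq> \<infinity>" using assms(1) by (auto simp: top_unique)
  moreover have "enn2real x \<le> r" using assms by (metis enn2real_leI)
  ultimately show ?thesis
    using assms by (auto simp: ennpowr_def intro!: ennreal_leI powr_mono2)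
qed

lemma ennpowr_less_top: "x < \<infinity> \<Longrightarrow> ennpowr x a < \<infinity>"
  by (auto simp: ennpowr_def)

lemma ennpowr_0 [simp]: "ennpowr 0 a = 0"
  by (simp add: ennpowr_def)

section \<open>A measure with lacunary atoms\<close>

definition diag_point :: "nat \<Rightarrow> real ^ 'n" where
  "diag_point k = (\<chi> i. 2 ^ k)"

lemma norm_diag_point_ge: "2 ^ k \<le> norm (diag_point k :: real ^ 'n)"
  using component_le_norm_cart[of "diag_point k :: real ^ 'n" undefined]
  by (simp add: diag_point_def)

lemma norm_diag_point_le: "norm (diag_point k :: real ^ 'n) \<le> real CARD('n) * 2 ^ k"
  using norm_le_l1_cart[of "diag_point k :: real ^ 'n"] by (simp add: diag_point_def)

text \<open>
  The sum of the point masses \<open>4\<^sup>n\<^sup>k\<close> at the diagonal points, written as an image of a weighted counting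
  measure so that integrals against it become series.
\<close>

definition lacunary :: "(real ^ 'n) measure" where
  "lacunary =
     distr (density (count_space UNIV) (\<lambda>k. ennreal (4 ^ (CARD('n) * k)))) borel diag_point"

lemma sets_lacunary [measurable_cong, simp]: "sets lacunary = sets borel"
  by (simp add: lacunary_def)

lemma nn_integral_lacunary:
  fixes f :: "real ^ 'n \<Rightarrow> ennreal"
  assumes [measurable]: "f \<in> borel_measurable borel"
  shows "(\<integral>\<^sup>+ x. f x \<partial>lacunary) = (\<Sum>k. ennreal (4 ^ (CARD('n) * k)) * f (diag_point k))"
proof -
  let ?M = "density (count_space UNIV) (\<lambda>k. ennreal (4 ^ (CARD('n) * k)))"
  have "(\<integral>\<^sup>+ x. f x \<partial>lacunary) = (\<integral>\<^sup>+ k. f (diag_point k) \<partial>?M)"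
    unfolding lacunary_def by (rule nn_integral_distr) auto
  also have "\<dots> = (\<integral>\<^sup>+ k. ennreal (4 ^ (CARD('n) * k)) * f (diag_point k) \<partial>count_space UNIV)"
    by (rule nn_integral_density) auto
  finally show ?thesis by (simp add: nn_integral_count_space_nat)
qed

lemma emeasure_lacunary:
  fixes A :: "(real ^ 'n) set"
  assumes "A \<in> sets borel"
  shows "emeasure lacunary A = (\<Sum>k. ennreal (4 ^ (CARD('n) * k)) * indicator A (diag_point k))"
  using nn_integral_lacunary[of "indicator A"] assms by simp

lemma emeasure_lacunary_ge:
  fixes A :: "(real ^ 'n) set"
  assumes "A \<in> sets borel" and "diag_point k \<in> A"
  shows "ennreal (4 ^ (CARD('n) * k)) \<le> emeasure lacunary A"
proof -
  let ?f = "\<lambda>k. ennreal (4 ^ (CARD('n) * k)) * indicator A (diag_point k)"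
  have "sum ?f {k} \<le> suminf ?f" by (rule sum_le_suminf) auto
  then show ?thesis using assms by (simp add: emeasure_lacunary)
qed

text \<open>The atoms tend to infinity, so a ball meets only finitely many of them.\<close>

lemma locally_finite_lacunary: "locally_finite_borel (lacunary :: (real ^ 'n) measure)"
proof -
  have "\<exists>U. open U \<and> x \<in> U \<and> emeasure lacunary U < \<infinity>" for x :: "real ^ 'n"
  proof -
    obtain K :: nat where K: "norm x + 1 < 2 ^ K"
      using real_arch_pow[of 2 "norm x + 1"] by auto
    have out: "diag_point k \<notin> ball x 1" if "k \<notin> {..<K}" for k
    proof
      assume "diag_point k \<in> ball x 1"
      then have "norm (diag_point k :: real ^ 'n) < norm x + 1"
        using norm_triangle_sub[of "diag_point k" x] by (simp add: dist_norm norm_minus_commute)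
      moreover have "(2 :: real) ^ K \<le> 2 ^ k" using that by (intro power_increasing) auto
      ultimately show False using K norm_diag_point_ge[of k, where 'n='n] by linarith
    qed
    have "emeasure lacunary (ball x 1) =
        (\<Sum>k<K. ennreal (4 ^ (CARD('n) * k)) * indicator (ball x 1) (diag_point k))"
      unfolding emeasure_lacunary[OF borel_open[OF open_ball]]
      by (rule suminf_finite) (simp_all add: indicator_def out del: mem_ball)
    also have "\<dots> < \<infinity>"
      by (auto simp: less_top indicator_def ennreal_mult_less_top)
    finally show ?thesis by (intro exI[of _ "ball x 1"]) auto
  qed
  then show ?thesis by (auto simp: locally_finite_borel_def)
qed

text \<open>
  The coordinates of the diagonal points are positive and increasing, so a cube through the origin that
  contains one of them contains all earlier ones; nonzero measure says that it contains at least one,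
  and boundedness that there is a last one.
\<close>

lemma diag_points_in_cube:
  fixes a :: "real ^ 'n"
  assumes "0 \<in> cube a l" and "emeasure lacunary (cube a l) \<noteq> 0"
  obtains K where "{k. diag_point k \<in> cube a l} = {..K}"
proof -
  let ?S = "{k. diag_point k \<in> cube a l}"
  have ne: "?S \<noteq> {}"
  proof
    assume "?S = {}"
    then have "emeasure lacunary (cube a l) = 0" by (simp add: emeasure_lacunary)
    then show False using assms(2) by simp
  qed
  have down: "j \<in> ?S" if "k \<in> ?S" "j \<le> k" for j k
  proof -
    have "(2 :: real) ^ j \<le> 2 ^ k" using that by (intro power_increasing) auto
    moreover have "a $ i \<le> 0" "2 ^ k < a $ i + l" for i
      using that assms(1) by (auto simp: cube_def diag_point_def)
    moreover have "(0 :: real) \<le> 2 ^ j" by simp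
    ultimately have "a $ i \<le> 2 ^ j \<and> 2 ^ j < a $ i + l" for i
      by (smt (verit))
    then show ?thesis by (simp add: cube_def diag_point_def)
  qed
  obtain M :: nat where M: "a $ undefined + l < 2 ^ M"
    using real_arch_pow[of 2 "a $ undefined + l"] by auto
  have "k \<le> M" if "k \<in> ?S" for k
  proof (rule ccontr)
    assume "\<not> k \<le> M"
    then have "(2 :: real) ^ M \<le> 2 ^ k" by (intro power_increasing) auto
    moreover have "2 ^ k < a $ undefined + l" using that by (auto simp: cube_def diag_point_def)
    ultimately show False using M by linarith
  qed
  then have fin: "finite ?S" by (auto simp: finite_nat_set_iff_bounded_le)
  have "?S = {..Max ?S}"
  proof (rule set_eqI)
    fix k
    have "k \<in> ?S \<Longrightarrow> k \<le> Max ?S" using fin by (rule Max_ge)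
    moreover have "k \<le> Max ?S \<Longrightarrow> k \<in> ?S" using Max_in[OF fin ne] by (rule down)
    ultimately show "k \<in> ?S \<longleftrightarrow> k \<in> {..Max ?S}" unfolding atMost_iff by (rule iffI)
  qed
  then show ?thesis by (rule that)
qed

section \<open>The pivotal condition holds\<close>

lemma poisson_kernel_borel [measurable]:
  "(\<lambda>x :: real ^ 'n. ennreal ((side I / (side I + infdist x I)\<^sup>2) ^ CARD('n))) \<in> borel_measurable borel"
proof -
  have [measurable]: "(\<lambda>x. infdist x I) \<in> borel_measurable borel"
    by (intro borel_measurable_continuous_onI continuous_intros)
  show ?thesis by measurable
qed

text \<open>
  The mass of an atom is \<open>(4\<^sup>k)\<^sup>n\<close>, so it suffices to bound the \<open>n\<close>-th root \<open>4\<^sup>k l / (l + d)\<^sup>2\<close>. Giving up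
  the factor \<open>l / (l + d) \<le> 1\<close> removes the dependence on the cube, and \<open>norm_le_infdist_cube\<close> turns the
  remaining \<open>4\<^sup>k / (l + d)\<close> into a multiple of \<open>2\<^sup>k\<close>.
\<close>

lemma poisson_kernel_le:
  fixes a :: "real ^ 'n"
  assumes "l > 0" and "0 \<in> cube a l"
  shows "4 ^ (CARD('n) * k) *
           (side (cube a l) / (side (cube a l) + infdist (diag_point k) (cube a l))\<^sup>2) ^ CARD('n)
         \<le> real CARD('n) ^ CARD('n) * (2 ^ CARD('n)) ^ k"
proof -
  let ?N = "real CARD('n)" and ?d = "infdist (diag_point k) (cube a l)"
  have d: "?d \<ge> 0" by (rule infdist_nonneg)
  have N: "?N \<ge> 1" using zero_less_card_finite[where 'a='n] by linarith
  have "2 ^ k \<le> ?d + ?N * l"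
    using norm_diag_point_ge[of k, where 'n='n] norm_le_infdist_cube[OF assms(2), of "diag_point k"]
    by linarith
  also have "\<dots> \<le> ?N * (l + ?d)"
    using mult_right_mono[OF N d] by (simp add: algebra_simps)
  finally have far: "2 ^ k \<le> ?N * (l + ?d)" .
  have "l / (l + ?d)\<^sup>2 = l / (l + ?d) * (1 / (l + ?d))"
    by (simp add: power2_eq_square)
  also have "\<dots> \<le> 1 * (1 / (l + ?d))"
    using assms(1) d by (intro mult_right_mono) auto
  finally have "4 ^ k * (l / (l + ?d)\<^sup>2) \<le> 4 ^ k * (1 / (l + ?d))"
    by (intro mult_left_mono) auto
  also have "\<dots> \<le> ?N * 2 ^ k"
  proof -
    have "(4 :: real) ^ k = 2 ^ k * 2 ^ k" by (simp flip: power_mult_distrib)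
    also have "\<dots> \<le> 2 ^ k * (?N * (l + ?d))" using far by (intro mult_left_mono) auto
    finally show ?thesis using assms(1) d by (simp add: field_simps)
  qed
  finally have "(4 ^ k * (l / (l + ?d)\<^sup>2)) ^ CARD('n) \<le> (?N * 2 ^ k) ^ CARD('n)"
    using assms(1) by (intro power_mono) auto
  moreover have "(4 :: real) ^ (CARD('n) * k) = (4 ^ k) ^ CARD('n)"
    by (simp add: mult.commute flip: power_mult)
  moreover have "((2 :: real) ^ CARD('n)) ^ k = (2 ^ k) ^ CARD('n)"
    by (simp add: mult.commute flip: power_mult)
  ultimately show ?thesis
    by (simp only: side_cube[OF assms(1)] power_mult_distrib)
qed

text \<open>For ratio at least 2 the last term dominates the sum of all the others.\<close>

lemma geometric_sum_le:
  fixes q :: real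
  assumes "q \<ge> 2"
  shows "(\<Sum>k\<le>K. q ^ k) \<le> 2 * q ^ K"
proof (induction K)
  case (Suc K)
  have "2 * q ^ K \<le> q * q ^ K" using assms by (intro mult_right_mono) auto
  then show ?case using Suc by simp
qed simp

lemma poisson_restricted_le:
  fixes a :: "real ^ 'n"
  assumes "l > 0" and "0 \<in> cube a l"
    and [measurable]: "J \<in> sets borel" and J: "{k. diag_point k \<in> J} = {..K}"
  shows "poisson (cube a l) (density lacunary (indicator J))
         \<le> ennreal (2 * real CARD('n) ^ CARD('n) * (2 ^ CARD('n)) ^ K)"
proof -
  let ?ker = "\<lambda>x. (side (cube a l) / (side (cube a l) + infdist x (cube a l))\<^sup>2) ^ CARD('n)"
  let ?N = "real CARD('n) ^ CARD('n)" and ?q = "2 ^ CARD('n) :: real"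
  have J': "diag_point k \<in> J \<longleftrightarrow> k \<le> K" for k using J by auto
  have q: "2 \<le> ?q"
    using power_increasing[of 1 "CARD('n)" "2 :: real"] zero_less_card_finite[where 'a='n] by simp
  have "poisson (cube a l) (density lacunary (indicator J))
      = (\<integral>\<^sup>+ x. indicator J x * ennreal (?ker x) \<partial>lacunary)"
    unfolding poisson_def by (subst nn_integral_density) auto
  also have "\<dots> = (\<Sum>k. ennreal (4 ^ (CARD('n) * k)) *
      (indicator J (diag_point k) * ennreal (?ker (diag_point k))))"
    by (rule nn_integral_lacunary) measurable
  also have "\<dots> = (\<Sum>k\<le>K. ennreal (4 ^ (CARD('n) * k)) *
      (indicator J (diag_point k) * ennreal (?ker (diag_point k))))"
    by (rule suminf_finite) (auto simp: J')
  also have "\<dots> \<le> (\<Sum>k\<le>K. ennreal (?N * ?q ^ k))"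
  proof (rule sum_mono)
    fix k assume "k \<in> {..K}"
    then show "ennreal (4 ^ (CARD('n) * k)) *
      (indicator J (diag_point k) * ennreal (?ker (diag_point k))) \<le> ennreal (?N * ?q ^ k)"
      using poisson_kernel_le[OF assms(1,2), of k]
      by (simp add: J' ennreal_leI flip: ennreal_mult')
  qed
  also have "\<dots> = ennreal (?N * (\<Sum>k\<le>K. ?q ^ k))"
    by (simp add: sum_distrib_left)
  also have "\<dots> \<le> ennreal (?N * (2 * ?q ^ K))"
    using geometric_sum_le[OF q, of K] by (intro ennreal_leI mult_left_mono) auto
  finally show ?thesis by (simp add: ac_simps)
qed

text \<open>
  This is where \<open>p \<le> 2\<close> enters: with \<open>K\<close> the last atom in \<open>I0\<close>, the \<open>p\<close>-th power of \<open>2\<^sup>n\<^sup>K \<ge> 1\<close> is at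
  most its square \<open>4\<^sup>n\<^sup>K\<close>, which is the mass of that single atom.
\<close>

lemma pivotal_summand_le:
  fixes I0 I :: "(real ^ 'n) set"
  assumes p: "1 < p" "p \<le> 2"
    and I0: "I0 \<in> cubes" "emeasure lacunary I0 \<noteq> 0" and I: "I \<in> cubes" "0 \<in> I" "I \<subseteq> I0"
  shows "ennpowr (poisson I (density lacunary (indicator I0))) p
         \<le> ennreal ((2 * real CARD('n) ^ CARD('n)) powr p) * emeasure lacunary I0"
proof -
  let ?C = "2 * real CARD('n) ^ CARD('n)" and ?q = "2 ^ CARD('n) :: real"
  obtain a l where al: "I = cube a l" "l > 0" using I(1) by (auto simp: cubes_def)
  obtain b m where bm: "I0 = cube b m" "m > 0" using I0(1) by (auto simp: cubes_def)
  obtain K where K: "{k. diag_point k \<in> I0} = {..K}"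
    using diag_points_in_cube[of b m] I0 I bm by auto
  have [measurable]: "I0 \<in> sets borel" using bm by simp
  have q: "1 \<le> ?q ^ K" by (simp add: one_le_power)
  have "ennpowr (poisson I (density lacunary (indicator I0))) p \<le> ennreal ((?C * ?q ^ K) powr p)"
    using poisson_restricted_le[of l a I0 K] al I K p by (intro ennpowr_le) auto
  also have "\<dots> \<le> ennreal (?C powr p * 4 ^ (CARD('n) * K))"
  proof (rule ennreal_leI)
    have "(?q ^ K) powr p \<le> (?q ^ K) powr 2" using q p by (intro powr_mono) auto
    also have "\<dots> = (?q ^ K) ^ 2" using q by (subst powr_numeral) auto
    also have "\<dots> = 4 ^ (CARD('n) * K)"
      by (simp add: power_mult[symmetric] power2_eq_square power_mult_distrib[symmetric])
    finally show "(?C * ?q ^ K) powr p \<le> ?C powr p * 4 ^ (CARD('n) * K)"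
      by (subst powr_mult) (auto intro: mult_left_mono)
  qed
  also have "\<dots> = ennreal (?C powr p) * ennreal (4 ^ (CARD('n) * K))"
    by (simp add: ennreal_mult)
  also have "\<dots> \<le> ennreal (?C powr p) * emeasure lacunary I0"
    using emeasure_lacunary_ge[of I0 K] K by (intro mult_left_mono) auto
  finally show ?thesis .
qed

text \<open>At most one cube of a disjoint family contains the origin, so the sum has at most one nonzero term.\<close>

lemma pivotal_sum_le:
  fixes I0 :: "(real ^ 'n) set"
  assumes p: "1 < p" "p \<le> 2"
    and I0: "I0 \<in> cubes" "emeasure lacunary I0 \<noteq> 0" and D: "cube_decomposition I0 D"
  shows "(\<Sum>\<^sub>\<infinity>I\<in>D. emeasure (return borel 0) I *
            ennpowr (poisson I (density lacunary (indicator I0))) p)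
         \<le> ennreal ((2 * real CARD('n) ^ CARD('n)) powr p) * emeasure lacunary I0"
    (is "infsum ?f D \<le> ?B")
proof (cases "0 \<in> I0")
  case True
  then obtain J where J: "J \<in> D" "0 \<in> J" using D by (auto simp: cube_decomposition_def)
  have "?f I = 0" if "I \<in> D - {J}" for I
  proof -
    have "0 \<notin> I" using that J D by (auto simp: cube_decomposition_def disjoint_def)
    moreover have "I \<in> sets borel" using that D cubes_borel by (auto simp: cube_decomposition_def)
    ultimately show ?thesis by simp
  qed
  then have "infsum ?f D = infsum ?f {J}"
    using J by (intro infsum_cong_neutral) auto
  also have "\<dots> = ennpowr (poisson J (density lacunary (indicator I0))) p"
    using J D cubes_borel[of J] by (auto simp: cube_decomposition_def)
  also have "\<dots> \<le> ?B"
    using p I0 J D by (intro pivotal_summand_le) (auto simp: cube_decomposition_def)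
  finally show ?thesis .
next
  case False
  have "?f I = 0" if "I \<in> D" for I
  proof -
    have "0 \<notin> I" using that False D by (auto simp: cube_decomposition_def)
    moreover have "I \<in> sets borel" using that D cubes_borel by (auto simp: cube_decomposition_def)
    ultimately show ?thesis by simp
  qed
  then have "infsum ?f D = 0" by (rule infsum_0)
  then show ?thesis by simp
qed

lemma pivotal_V_finite:
  assumes p: "1 < p" "p \<le> 2"
  shows "pivotal_V p (return borel 0) (lacunary :: (real ^ 'n) measure) < \<infinity>"
proof -
  let ?C = "ennreal ((2 * real CARD('n) ^ CARD('n)) powr p)"
  let ?S = "SUP (I0, D) \<in> {(I0 :: (real ^ 'n) set, D).
      I0 \<in> cubes \<and> emeasure lacunary I0 \<noteq> 0 \<and> cube_decomposition I0 D}.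
    1 / emeasure lacunary I0 * (\<Sum>\<^sub>\<infinity>I\<in>D. emeasure (return borel 0) I *
      ennpowr (poisson I (density lacunary (indicator I0))) p)"
  have bound: "1 / emeasure lacunary I0 * (\<Sum>\<^sub>\<infinity>I\<in>D. emeasure (return borel 0) I *
      ennpowr (poisson I (density lacunary (indicator I0))) p) \<le> ?C"
    if I0: "I0 \<in> cubes" "emeasure lacunary I0 \<noteq> 0" and D: "cube_decomposition I0 D"
    for I0 :: "(real ^ 'n) set" and D
  proof -
    let ?s = "emeasure lacunary I0"
    have "1 / ?s * (\<Sum>\<^sub>\<infinity>I\<in>D. emeasure (return borel 0) I *
        ennpowr (poisson I (density lacunary (indicator I0))) p) \<le> 1 / ?s * (?C * ?s)"
      by (rule mult_left_mono[OF pivotal_sum_le[OF p I0 D] zero_le])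
    also have "\<dots> = ?C * (?s / ?s)"
      unfolding divide_ennreal_def by (simp only: mult_1_left mult.assoc mult.commute mult.left_commute)
    also have "\<dots> \<le> ?C * 1"
    proof (rule mult_left_mono)
      \<comment> \<open>In extended nonnegative reals, \<open>\<infinity> / \<infinity> = 0\<close>.\<close>
      show "?s / ?s \<le> 1"
        using I0(2) by (cases "?s = top") (simp_all add: ennreal_divide_self less_top)
    qed (rule zero_le)
    finally show ?thesis by (simp only: mult_1_right)
  qed
  have "?S \<le> ?C"
    by (rule SUP_least) (clarify, rule bound)
  then have "?S < \<infinity>" by (rule le_less_trans) simp
  then show ?thesis unfolding pivotal_V_def by (rule ennpowr_less_top)
qed

section \<open>The one tailed condition fails\<close>

text \<open>
  The distance of the \<open>k\<close>-th atom to the unit cube is at most \<open>n 2\<^sup>k\<close>, so the mass \<open>4\<^sup>n\<^sup>k\<close> makes up for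
  the decay of the kernel, and the Poisson integral is a series whose terms are bounded away from 0.
\<close>

lemma poisson_lacunary_infinite: "poisson (cube 0 1 :: (real ^ 'n) set) lacunary = \<infinity>"
proof -
  let ?I = "cube 0 1 :: (real ^ 'n) set"
  let ?ker = "\<lambda>x. (side ?I / (side ?I + infdist x ?I)\<^sup>2) ^ CARD('n)"
  let ?c = "(1 / (real CARD('n) + 1)\<^sup>2) ^ CARD('n)"
  have ge: "ennreal ?c \<le> ennreal (4 ^ (CARD('n) * k)) * ennreal (?ker (diag_point k))" for k
  proof -
    let ?d = "infdist (diag_point k) ?I"
    have "0 \<in> ?I" by (simp add: cube_def)
    then have "?d \<le> real CARD('n) * 2 ^ k"
      using infdist_le[of 0 ?I "diag_point k"] norm_diag_point_le[of k, where 'n='n] by simp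
    moreover have "(1 :: real) \<le> 2 ^ k" by simp
    ultimately have "1 + ?d \<le> (real CARD('n) + 1) * 2 ^ k"
      unfolding distrib_right by linarith
    then have "(1 + ?d)\<^sup>2 \<le> ((real CARD('n) + 1) * 2 ^ k)\<^sup>2"
      by (intro power_mono) (auto simp: infdist_nonneg add_nonneg_nonneg)
    also have "\<dots> = (real CARD('n) + 1)\<^sup>2 * (2 ^ k)\<^sup>2"
      by (rule power_mult_distrib)
    also have "((2 :: real) ^ k)\<^sup>2 = 4 ^ k"
      by (simp add: power2_eq_square flip: power_mult_distrib)
    finally have upper: "(1 + ?d)\<^sup>2 \<le> (real CARD('n) + 1)\<^sup>2 * 4 ^ k" .
    have "0 < (1 + ?d)\<^sup>2" using infdist_nonneg[of "diag_point k" ?I] by (intro zero_less_power) linarith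
    moreover have "0 < (real CARD('n) + 1)\<^sup>2" by (intro zero_less_power) linarith
    ultimately have "1 / (real CARD('n) + 1)\<^sup>2 \<le> 4 ^ k * (1 / (1 + ?d)\<^sup>2)"
      using upper by (simp add: divide_simps mult.commute)
    then have "?c \<le> (4 ^ k * (1 / (1 + ?d)\<^sup>2)) ^ CARD('n)"
      by (intro power_mono) auto
    also have "\<dots> = 4 ^ (CARD('n) * k) * ?ker (diag_point k)"
      by (simp only: power_mult_distrib side_cube zero_less_one power_mult mult.commute[of "CARD('n)" k])
    finally show ?thesis by (simp add: ennreal_leI flip: ennreal_mult')
  qed
  have "poisson ?I lacunary = (\<Sum>k. ennreal (4 ^ (CARD('n) * k)) * ennreal (?ker (diag_point k)))"
    unfolding poisson_def by (rule nn_integral_lacunary) measurable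
  moreover have "(\<Sum>k :: nat. ennreal ?c) = \<infinity>"
  proof -
    have "ennreal ?c \<noteq> 0" by (simp add: add_pos_pos)
    then have "(\<integral>\<^sup>+ k. ennreal ?c \<partial>count_space (UNIV :: nat set)) = \<infinity>"
      by (simp add: ennreal_mult_top)
    then show ?thesis by (simp only: nn_integral_count_space_nat)
  qed
  moreover have "(\<Sum>k :: nat. ennreal ?c)
      \<le> (\<Sum>k. ennreal (4 ^ (CARD('n) * k)) * ennreal (?ker (diag_point k)))"
    by (intro suminf_le ge) auto
  ultimately show ?thesis by (simp add: top_unique)
qed

lemma one_tailed_A_infinite:
  "one_tailed_A p (return borel 0) (lacunary :: (real ^ 'n) measure) = \<infinity>"
proof -
  let ?I = "cube 0 1 :: (real ^ 'n) set"
  have I: "?I \<in> cubes" "0 \<in> ?I" unfolding cubes_def using zero_less_one by blast (simp add: cube_def)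
  have "ennpowr (emeasure (return borel 0) ?I / emeasure lborel ?I) (1 / p)
      * ennpowr (poisson ?I lacunary) (1 / (p / (p - 1))) = \<infinity>"
    using I by (simp add: emeasure_lborel_cube poisson_lacunary_infinite ennpowr_def)
  then show ?thesis
    unfolding one_tailed_A_def using SUP_upper[OF I(1)] by (metis (no_types, lifting) infinity_ennreal_def top_unique)
qed

theorem theorem6:
  fixes p :: real
  assumes "1 < p" and "p \<le> 2"
  shows "\<exists>(\<omega> :: (real ^ 'n) measure) (\<sigma> :: (real ^ 'n) measure).
           locally_finite_borel \<omega> \<and> locally_finite_borel \<sigma> \<and>
           pivotal_V p \<omega> \<sigma> < \<infinity> \<and> one_tailed_A p \<omega> \<sigma> = \<infinity>"
proof (intro exI conjI)
  show "locally_finite_borel (return borel (0 :: real ^ 'n))"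
    unfolding locally_finite_borel_def by (auto intro!: exI[of _ UNIV])
  show "locally_finite_borel (lacunary :: (real ^ 'n) measure)"
    by (rule locally_finite_lacunary)
  show "pivotal_V p (return borel 0) (lacunary :: (real ^ 'n) measure) < \<infinity>"
    using assms by (rule pivotal_V_finite)
  show "one_tailed_A p (return borel 0) (lacunary :: (real ^ 'n) measure) = \<infinity>"
    by (rule one_tailed_A_infinite)
qed

end
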